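(* Let $B_n$ be a bouquet with $n\ge 3$ edges, and suppose its intersection graph is $K_{i,j,k}$ (so $n=i+j+k$), where either $k=0$, or $i+j\ge 3$ and $k\ne 0$. Let $n_o$ be the number of odd elements among $i,j,k$. Then $$^{\partial}\varepsilon_{B_n}^{\times}(z)=\begin{cases} z^{n}+\sum\limits_{d=2}^{n}g_d z^d, & \text{if } n_o=0,\\ z^{n+1-n_o}+\sum\limits_{d=2}^{n}g_d z^d, & \text{if } n_o\ge 1,\end{cases}$$ where $$\begin{aligned} g_d=\;&\overline{\binom{i}{d-2\left\lceil\frac{j+k}{2}\right\rceil}}+\overline{\binom{j}{d-2\left\lceil\frac{i+k}{2}\right\rceil}}+\overline{\binom{k}{d-2\left\lceil\frac{i+j}{2}\right\rceil}}+\sum_{a=0}^{i-1}\binom{i}{a}\overline{\binom{j}{d-2-k-a}}\\ &+\sum_{a=0}^{i-1}\binom{i}{a}\overline{\binom{k}{d-2-j-a}}+\sum_{a=0}^{i}\sum_{b=0}^{j-1}\binom{i}{a}\binom{j}{b}\,\overline{\binom{k}{d-2-a-b}}.\end{aligned}$$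
   Context: A ribbon graph $G$ is a surface with boundary represented as the union of two finite sets of closed topological discs, vertex-discs $V(G)$ and edge-ribbons $E(G)$, such that: vertex-discs and edge-ribbons intersect in disjoint line segments; each such segment lies on the boundary of precisely one vertex-disc and precisely one edge-ribbon; every edge-ribbon contains exactly two such segments. All graphs are connected (loops and multiple edges allowed). Let $F(G)$ be the set of faces (boundary components of the surface) and $c(G)$ the number of connected components. The Euler genus is $\varepsilon(G)=2c(G)-|V(G)|+|E(G)|-|F(G)|$. For $A\subseteq E(G)$, the partial Petrial $G^{\times|A}$ is obtained by detaching one end of each edge-ribbon in $A$ from its incident vertex-disc, giving the edge a half-twist, and reattaching it. The partial Petrial polynomial is $^{\partial}\varepsilon_G^{\times}(z)=\sum_{A\subseteq E(G)}z^{\varepsilon(G^{\times|A})}$. A bouquet is a ribbon graph with exactly one vertex-disc. Two edges (loops) of a bouquet are interlaced if their half-edges alternate in the cyclic order of half-edges around the vertex-disc. The intersection graph $I(B)$ of a bouquet $B$ has the loops of $B$ as vertices, two being adjacent if and only if the loops are interlaced. $K_{i,j,k}$ (with $i,j\ge 1$, $k\ge 0$) denotes the complete tripartite graph with parts of sizes $i,j,k$ when $k\neq 0$, and $K_{i,j,0}$ denotes the complete bipartite graph $K_{i,j}$. Conventions: a sum $\sum_{a=c_1}^{c_2}$ with $c_1>c_2$ is $0$; $\binom{m}{r}=0$ if $r<0$ or $r>m$ or $m=0$; and $\overline{\binom{m}{r}}=\binom{m}{r}$ if $0\le r\le m-1$, while $\overline{\binom{m}{r}}=0$ if $r<0$ or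 $r\ge m$. *)

theory Defs
  imports "Graph_Theory.Graph_Theory" "HOL-Computational_Algebra.Polynomial" Complex_Main
begin

text \<open>
  A ribbon graph is encoded by its signed rotation system.  The ribbon \<open>e\<close> has the two
  half-edges \<open>(e, False)\<close> and \<open>(e, True)\<close>, standing for the two line segments in which it meets
  the vertex-discs.  Every vertex-disc is given an orientation; \<open>rotation G v\<close> lists the half-edges
  on the boundary of \<open>v\<close> in the resulting cyclic order (only the cyclic order matters).  A ribbon
  is in \<open>twisted G\<close> if it is glued with a half-twist relative to these orientations.
\<close>

record ('v, 'e) ribbon_graph =
  vertex_discs :: "'v set"
  ribbons :: "'e set"
  rotation :: "'v \<Rightarrow> ('e \<times> bool) list"
  twisted :: "'e set"

definition half_edges :: "('v, 'e) ribbon_graph \<Rightarrow> ('e \<times> bool) set" where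
  "half_edges G = ribbons G \<times> UNIV"

definition ribbon_graph :: "('v, 'e) ribbon_graph \<Rightarrow> bool" where
  "ribbon_graph G \<longleftrightarrow>
     finite (vertex_discs G) \<and> finite (ribbons G) \<and> twisted G \<subseteq> ribbons G \<and>
     (\<forall>v\<in>vertex_discs G. distinct (rotation G v)) \<and>
     (\<forall>v\<in>vertex_discs G. \<forall>w\<in>vertex_discs G. v \<noteq> w \<longrightarrow>
        set (rotation G v) \<inter> set (rotation G w) = {}) \<and>
     (\<Union>v\<in>vertex_discs G. set (rotation G v)) = half_edges G"

definition components :: "('v, 'e) ribbon_graph \<Rightarrow> 'v set set" where
  "components G = vertex_discs G //
     {(v, w). v \<in> vertex_discs G \<and> w \<in> vertex_discs G \<and>
        (\<exists>e s t. (e, s) \<in> set (rotation G v) \<and> (e, t) \<in> set (rotation G w))}\<^sup>*"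

text \<open>
  Boundary components.  The segment of a half-edge \<open>h\<close> has two end points: following the
  orientation of its vertex-disc, it runs from the corner \<open>(h, False)\<close> to the corner \<open>(h, True)\<close>.
  The boundary of the surface is cut at the corners into free arcs of vertex-discs, which join
  \<open>(h, True)\<close> to \<open>(h', False)\<close> where \<open>h'\<close> is the cyclic successor of \<open>h\<close>, and free sides of
  ribbons.  The two sides of a ribbon join opposite kinds of corners if it is untwisted and equal
  kinds if it is twisted.
\<close>

definition corners :: "('v, 'e) ribbon_graph \<Rightarrow> (('e \<times> bool) \<times> bool) set" where
  "corners G = half_edges G \<times> UNIV"

definition vertex_arcs :: "('v, 'e) ribbon_graph \<Rightarrow> (('e \<times> bool) \<times> bool) rel" where
  "vertex_arcs G =
     {((rotation G v ! p, True), (rotation G v ! (Suc p mod length (rotation G v)), False)) |v p.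
        v \<in> vertex_discs G \<and> p < length (rotation G v)}"

definition ribbon_sides :: "('v, 'e) ribbon_graph \<Rightarrow> (('e \<times> bool) \<times> bool) rel" where
  "ribbon_sides G =
     {(((e, False), s), ((e, True), \<not> s)) |e s. e \<in> ribbons G - twisted G} \<union>
     {(((e, False), s), ((e, True), s)) |e s. e \<in> ribbons G \<inter> twisted G}"

definition boundary_joined :: "('v, 'e) ribbon_graph \<Rightarrow> (('e \<times> bool) \<times> bool) rel" where
  "boundary_joined G =
     (vertex_arcs G \<union> (vertex_arcs G)\<inverse> \<union> ribbon_sides G \<union> (ribbon_sides G)\<inverse>)\<^sup>*"

text \<open>
  A vertex-disc meeting no ribbon has no corners; its whole boundary circle is one further face.
\<close>

definition faces ::
  "('v, 'e) ribbon_graph \<Rightarrow> ((('e \<times> bool) \<times> bool) set + 'v) set" where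
  "faces G = (corners G // boundary_joined G) <+> {v \<in> vertex_discs G. rotation G v = []}"

definition euler_genus :: "('v, 'e) ribbon_graph \<Rightarrow> int" where
  "euler_genus G = 2 * int (card (components G)) - int (card (vertex_discs G))
     + int (card (ribbons G)) - int (card (faces G))"

text \<open>
  Detaching one end of a ribbon, giving it a half-twist and reattaching it at the same place keeps
  the rotations and changes whether the ribbon is twisted.
\<close>

definition partial_petrial ::
  "('v, 'e) ribbon_graph \<Rightarrow> 'e set \<Rightarrow> ('v, 'e) ribbon_graph" where
  "partial_petrial G A = G\<lparr>twisted := (twisted G - A) \<union> (A - twisted G)\<rparr>"

text \<open>The Euler genus of a ribbon graph is nonnegative, so \<^const>\<open>nat\<close> loses nothing here.\<close>

definition partial_petrial_polynomial :: "('v, 'e) ribbon_graph \<Rightarrow> int poly" where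
  "partial_petrial_polynomial G =
     (\<Sum>A\<in>Pow (ribbons G). monom 1 (nat (euler_genus (partial_petrial G A))))"

definition bouquet :: "('v, 'e) ribbon_graph \<Rightarrow> bool" where
  "bouquet G \<longleftrightarrow> ribbon_graph G \<and> card (vertex_discs G) = 1"

text \<open>
  Only the four half-edges of \<open>e\<close> and \<open>f\<close> are kept of the rotation.  Both listed patterns are
  needed, since a cyclic order may be written down starting anywhere.
\<close>

definition interlaced :: "('v, 'e) ribbon_graph \<Rightarrow> 'e \<Rightarrow> 'e \<Rightarrow> bool" where
  "interlaced G e f \<longleftrightarrow> e \<noteq> f \<and>
     (\<exists>v\<in>vertex_discs G.
        filter (\<lambda>x. x = e \<or> x = f) (map fst (rotation G v)) \<in> {[e, f, e, f], [f, e, f, e]})"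

definition intersection_graph :: "('v, 'e) ribbon_graph \<Rightarrow> 'e pair_pre_digraph" where
  "intersection_graph B =
     \<lparr>pverts = ribbons B,
      parcs = {(e, f). e \<in> ribbons B \<and> f \<in> ribbons B \<and> interlaced B e f}\<rparr>"

text \<open>
  As in \<^const>\<open>complete_bipartite_digraph\<close>, being such a graph means being isomorphic to it, and an
  undirected edge is a pair of opposite arcs.
\<close>

definition complete_tripartite_digraph ::
  "nat \<Rightarrow> nat \<Rightarrow> nat \<Rightarrow> ('a, 'b) pre_digraph \<Rightarrow> bool" where
  "complete_tripartite_digraph i j k G \<longleftrightarrow> graph G \<and>
     (\<exists>U V W. verts G = U \<union> V \<union> W \<and> U \<inter> V = {} \<and> U \<inter> W = {} \<and> V \<inter> W = {} \<and>
        card U = i \<and> card V = j \<and> card W = k \<and>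
        arcs_ends G = U \<times> V \<union> V \<times> U \<union> U \<times> W \<union> W \<times> U \<union> V \<times> W \<union> W \<times> V)"

definition is_K :: "nat \<Rightarrow> nat \<Rightarrow> nat \<Rightarrow> ('a, 'b) pre_digraph \<Rightarrow> bool" where
  "is_K i j k G \<longleftrightarrow>
     (if k = 0 then complete_bipartite_digraph i j G else complete_tripartite_digraph i j k G)"

text \<open>
  Binomial coefficients with an integer lower argument, with the conventions
  \<open>binom m r = 0\<close> if \<open>r < 0\<close>, \<open>r > m\<close> or \<open>m = 0\<close>; in \<open>binom_bar\<close> also \<open>r = m\<close> gives \<open>0\<close>.
\<close>

definition binom :: "nat \<Rightarrow> int \<Rightarrow> nat" where
  "binom m r = (if r < 0 \<or> r > int m \<or> m = 0 then 0 else m choose nat r)"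

definition binom_bar :: "nat \<Rightarrow> int \<Rightarrow> nat" where
  "binom_bar m r = (if 0 \<le> r \<and> r \<le> int m - 1 then binom m r else 0)"

definition num_odd :: "nat \<Rightarrow> nat \<Rightarrow> nat \<Rightarrow> nat" where
  "num_odd i j k = length (filter odd [i, j, k])"

text \<open>
  The summation bounds are integers, so that a range ending at \<open>int i - 1\<close> is never truncated.
\<close>

definition g :: "nat \<Rightarrow> nat \<Rightarrow> nat \<Rightarrow> nat \<Rightarrow> nat" where
  "g i j k d =
     binom_bar i (int d - 2 * \<lceil>real (j + k) / 2\<rceil>)
   + binom_bar j (int d - 2 * \<lceil>real (i + k) / 2\<rceil>)
   + binom_bar k (int d - 2 * \<lceil>real (i + j) / 2\<rceil>)
   + (\<Sum>a = 0..int i - 1. binom i a * binom_bar j (int d - 2 - int k - a))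
   + (\<Sum>a = 0..int i - 1. binom i a * binom_bar k (int d - 2 - int j - a))
   + (\<Sum>a = 0..int i. \<Sum>b = 0..int j - 1.
        binom i a * binom j b * binom_bar k (int d - 2 - a - b))"

end

theory Submission
  imports Defs
begin

text \<open>
  Partial Petrials leave the cyclic order around the only vertex-disc alone and replace the set of
  twisted loops by an arbitrary set \<open>T\<close>.  So the polynomial is the sum of \<open>z\<close> to the Euler genus over
  all \<open>T\<close>, and everything rests on a formula for that genus.  Let \<open>M\<close> be the adjacency matrix over
  GF(2) of the intersection graph, with diagonal entry 1 exactly at the loops in \<open>T\<close>.  Then the Euler
  genus is the rank of \<open>M\<close>, that is, the number of faces is one more than the nullity of \<open>M\<close>.

  To see this without homology, colour the faces with two colours and let \<open>X\<close> be the set of loops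
  whose two sides get different colours.  Walking round the vertex-disc, the colour of the boundary
  changes exactly at the half-edges in \<open>X\<close>; so \<open>X\<close> and one starting colour determine the
  colouring, and conversely any \<open>X\<close> and starting colour give a colouring of the free arcs of the disc.
  This colouring is compatible with gluing a ribbon \<open>e\<close> iff the number of changes met between
  the two ends of \<open>e\<close> has the right parity.  A loop of \<open>X\<close> has one end between those of \<open>e\<close> iff it is
  interlaced with \<open>e\<close>, so this condition is row \<open>e\<close> of \<open>M X = 0\<close>.  Hence
  \<open>2 ^ faces = 2 * card (kernel M)\<close>; this is \<open>card_saturated_corner_sets\<close>, and
  \<open>euler_genus_eq_corank\<close> is its consequence for the genus.

  When the graph is complete tripartite, row \<open>e\<close> depends only on the parities of \<open>X\<close> in the two parts
  not containing \<open>e\<close>.  So the kernel is counted by prescribing three parities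
  (\<open>card_tripartite_kernel\<close>).  The result depends on which parts lie inside \<open>T\<close>.  If all do, the rank
  is \<open>n\<close> or \<open>n + 1 - n\<^sub>o\<close>, which is the isolated term of the polynomial.  Otherwise the rank is \<open>card T\<close>
  plus a correction: 2 if at least two parts are not inside \<open>T\<close>, and, if only one is not, the parity
  of the total size of the other two.  Counting the sets \<open>T\<close> of each kind by their sizes gives the six
  summands of \<open>g\<close> (\<open>count_by_rank\<close>).  Complete bipartite graphs are the case of an empty third part,
  which lies inside every \<open>T\<close>.
\<close>

section \<open>Faces of a one-disc ribbon graph and the parity kernel\<close>

text \<open>
  A set respecting \<open>r\<close> is a union of classes, so counting such sets counts the subsets of the quotient.
\<close>

lemma card_saturated_sets:
  assumes fin: "finite C" and r: "r \<subseteq> C \<times> C"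
  shows "card {S. S \<subseteq> C \<and> (\<forall>(x, y)\<in>r. x \<in> S \<longleftrightarrow> y \<in> S)} = 2 ^ card (C // (r \<union> r\<inverse>)\<^sup>*)"
proof -
  let ?R = "(r \<union> r\<inverse>)\<^sup>*"
  let ?Sat = "{S. S \<subseteq> C \<and> (\<forall>(x, y)\<in>r. x \<in> S \<longleftrightarrow> y \<in> S)}"
  have sym: "(y, x) \<in> ?R" if "(x, y) \<in> ?R" for x y
    using that sym_rtrancl[OF sym_Un_converse] by (meson symE)
  have closed: "y \<in> S" if "(x, y) \<in> ?R" "x \<in> S" "S \<in> ?Sat" for x y S
    using that by (induction rule: rtrancl_induct) auto
  have "C \<in> ?Sat"
    using r by auto
  then have sub: "?R `` {x} \<subseteq> C" if "x \<in> C" for x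
    using closed that by blast
  have meet: "c = d" if cd: "c \<in> C // ?R" "d \<in> C // ?R" and x: "x \<in> c" "x \<in> d" for c d x
  proof -
    have same: "?R `` {z} = ?R `` {w}" if "(z, w) \<in> ?R" for z w
      using that sym[OF that] by (auto intro: rtrancl_trans)
    obtain z w where "c = ?R `` {z}" "d = ?R `` {w}"
      using cd by (auto elim!: quotientE)
    then show ?thesis
      using x same[of z x] same[of w x] by simp
  qed
  have "bij_betw Union (Pow (C // ?R)) ?Sat"
  proof (rule bij_betw_imageI)
    show "inj_on Union (Pow (C // ?R))"
    proof (rule inj_onI)
      have *: "D \<subseteq> D'" if D: "D \<subseteq> C // ?R" "D' \<subseteq> C // ?R" "\<Union>D = \<Union>D'" for D D'
      proof
        fix c assume c: "c \<in> D"
        then obtain x where "x \<in> c"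
          using D(1) by (force elim!: quotientE)
        then obtain d where "d \<in> D'" "x \<in> d"
          using c D(3) by blast
        then show "c \<in> D'"
          using meet[of c d x] \<open>x \<in> c\<close> c D by auto
      qed
      fix D D' assume "D \<in> Pow (C // ?R)" "D' \<in> Pow (C // ?R)" "\<Union>D = \<Union>D'"
      then show "D = D'"
        using *[of D D'] *[of D' D] by auto
    qed
    show "Union ` Pow (C // ?R) = ?Sat"
    proof (intro equalityI subsetI)
      fix S assume "S \<in> Union ` Pow (C // ?R)"
      then obtain D where D: "D \<subseteq> C // ?R" "S = \<Union>D"
        by auto
      have step: "y \<in> S" if xy: "(x, y) \<in> r \<union> r\<inverse>" and xS: "x \<in> S" for x y
      proof -
        obtain c where c: "c \<in> D" "x \<in> c"
          using D xS by auto
        then obtain z where "c = ?R `` {z}"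
          using D(1) by (auto elim!: quotientE)
        then have "y \<in> c"
          using c xy by (auto intro: rtrancl_into_rtrancl)
        then show ?thesis
          using c D by auto
      qed
      have "S \<subseteq> C"
        using D sub by (fastforce elim!: quotientE)
      then show "S \<in> ?Sat"
        using step by blast
    next
      fix S assume S: "S \<in> ?Sat"
      have "S = \<Union>((\<lambda>x. ?R `` {x}) ` S)"
        using closed[OF _ _ S] by auto
      moreover have "(\<lambda>x. ?R `` {x}) ` S \<subseteq> C // ?R"
        using S by (auto intro: quotientI)
      ultimately show "S \<in> Union ` Pow (C // ?R)"
        by blast
    qed
  qed
  then have "card ?Sat = card (Pow (C // ?R))"
    by (simp add: bij_betw_same_card)
  also have "finite (C // ?R)"
    unfolding quotient_def using fin by simp
  then have "card (Pow (C // ?R)) = 2 ^ card (C // ?R)"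
    by (simp add: card_Pow)
  finally show ?thesis .
qed

text \<open>
  The kernel over GF(2) of the adjacency matrix of the intersection graph with 1 on the diagonal at
  the twisted loops; vectors are represented by their supports.
\<close>

definition parity_kernel :: "('v, 'e) ribbon_graph \<Rightarrow> 'e set set" where
  "parity_kernel G = {X. X \<subseteq> ribbons G \<and>
     (\<forall>e\<in>ribbons G. (e \<in> X \<and> e \<in> twisted G) \<longleftrightarrow> odd (card {f \<in> X. interlaced G e f}))}"

lemma three_summands_of_two:
  "a + m + c = (2::nat) \<Longrightarrow>
    (a, m, c) \<in> {(2,0,0), (0,2,0), (0,0,2), (1,1,0), (1,0,1), (0,1,1)}"
  by (cases a; cases m; cases c) auto

lemma filter_two_eq_replicate:
  "e \<notin> set xs \<Longrightarrow> filter (\<lambda>x. x = e \<or> x = f) xs = replicate (count_list xs f) f"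
  by (induction xs) auto

text \<open>
  The facts below need the list of half-edges around the only vertex-disc as a fixed object with
  positions, hence a locale that names the disc.
\<close>

locale one_disc =
  fixes G :: "('v, 'e) ribbon_graph" and v :: 'v
  assumes ribbon_graph: "ribbon_graph G" and disc: "vertex_discs G = {v}"
begin

abbreviation R :: "('e \<times> bool) list" where "R \<equiv> rotation G v"

definition prefix_count :: "'e set \<Rightarrow> nat \<Rightarrow> nat" where
  "prefix_count X p = length (filter (\<lambda>h. fst h \<in> X) (take p R))"

text \<open>
  The corners of one colour, when position 0 has the colour \<open>b\<close> and the colour changes at the half-edges
  of the ribbons in \<open>X\<close>.  The corner before position \<open>p\<close> has seen \<open>p\<close> half-edges and the corner after
  it \<open>Suc p\<close>.
\<close>

definition colouring :: "bool \<Rightarrow> 'e set \<Rightarrow> (('e \<times> bool) \<times> bool) set" where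
  "colouring b X = {(R ! p, s) |p s. p < length R \<and> (b \<noteq> odd (prefix_count X (if s then Suc p else p)))}"

lemma distinct_R: "distinct R"
  and set_R: "set R = ribbons G \<times> UNIV"
  and finite_ribbons: "finite (ribbons G)"
  using ribbon_graph disc by (auto simp: ribbon_graph_def half_edges_def)

lemma R_nonempty: "ribbons G \<noteq> {} \<Longrightarrow> R \<noteq> []"
  using set_R by (metis Times_empty UNIV_not_empty set_empty)

lemma ribbon_at: "p < length R \<Longrightarrow> fst (R ! p) \<in> ribbons G"
  using set_R nth_mem[of p R] by (cases "R ! p") auto

lemma half_edge_at:
  assumes "e \<in> ribbons G"
  shows "\<exists>p < length R. R ! p = (e, t)"
proof -
  have "(e, t) \<in> set R"
    using assms by (simp add: set_R)
  then show ?thesis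
    by (simp add: in_set_conv_nth)
qed

lemma corners_nth: "corners G = {(R ! p, s) |p s. p < length R}"
  unfolding corners_def half_edges_def set_R[symmetric] by (force simp: in_set_conv_nth)

lemma mem_colouring:
  "p < length R \<Longrightarrow>
    (R ! p, s) \<in> colouring b X \<longleftrightarrow> (b \<noteq> odd (prefix_count X (if s then Suc p else p)))"
  unfolding colouring_def using distinct_R by (auto simp: nth_eq_iff_index_eq)

lemma prefix_count_0: "prefix_count X 0 = 0"
  by (simp add: prefix_count_def)

lemma prefix_count_Suc: "p < length R \<Longrightarrow> prefix_count X (Suc p) = prefix_count X p + of_bool (fst (R ! p) \<in> X)"
  by (simp add: prefix_count_def take_Suc_conv_app_nth)

text \<open>
  Both ends of a ribbon are on the disc, so the colour is back at its start after one full turn.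
\<close>

lemma even_prefix_count_all:
  assumes "X \<subseteq> ribbons G"
  shows "even (prefix_count X (length R))"
proof -
  have "prefix_count X (length R) = card (set (filter (\<lambda>h. fst h \<in> X) R))"
    using distinct_R unfolding prefix_count_def by (metis distinct_card distinct_filter order_refl take_all)
  also have "set (filter (\<lambda>h. fst h \<in> X) R) = X \<times> UNIV"
    using assms set_R by auto
  also have "card (X \<times> (UNIV :: bool set)) = 2 * card X"
    by (simp add: card_cartesian_product)
  finally show ?thesis
    by simp
qed

lemma count_ribbon:
  assumes "f \<in> ribbons G"
  shows "count_list (map fst R) f = 2"
proof -
  have "count_list (map fst R) f = length (filter (\<lambda>h. fst h = f) R)"
    by (simp add: count_list_eq_length_filter filter_map comp_def eq_commute)
  also have "\<dots> = card (set (filter (\<lambda>h. fst h = f) R))"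
    using distinct_R by (metis distinct_card distinct_filter)
  also have "set (filter (\<lambda>h. fst h = f) R) = {f} \<times> UNIV"
    using assms set_R by auto
  also have "card ({f} \<times> (UNIV :: bool set)) = 2"
    by (simp add: card_cartesian_product)
  finally show ?thesis .
qed

text \<open>
  A ribbon with both ends between the two ends of \<open>e\<close>, or with none there, contributes an even number
  of colour changes on that stretch; an interlaced one contributes exactly one.
\<close>

lemma odd_prefix_count_between_less:
  assumes X: "X \<subseteq> ribbons G" and pq: "p < q" "q < length R"
    and p: "fst (R ! p) = e" and q: "fst (R ! q) = e"
  shows "odd (prefix_count X (Suc p)) \<noteq> odd (prefix_count X q) \<longleftrightarrow> odd (card {f \<in> X. interlaced G e f})"
proof -
  define A where "A = map fst (take p R)"
  define M where "M = map fst (drop (Suc p) (take q R))"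
  define C where "C = map fst (drop (Suc q) R)"
  have tq: "take q R = take (Suc p) R @ drop (Suc p) (take q R)"
    using pq by (metis Suc_leI append_take_drop_id min.absorb1 take_take)
  have "R = take q R @ R ! q # drop (Suc q) R"
    using pq by (metis id_take_nth_drop)
  also have "take q R = take p R @ R ! p # drop (Suc p) (take q R)"
    using tq pq by (simp add: take_Suc_conv_app_nth)
  finally have "map fst R = map fst
      ((take p R @ R ! p # drop (Suc p) (take q R)) @ R ! q # drop (Suc q) R)"
    by (rule arg_cong)
  then have split: "map fst R = A @ e # M @ e # C"
    by (simp add: p q A_def M_def C_def)
  have "e \<in> ribbons G"
    using ribbon_at[of p] pq p by simp
  then have "count_list A e + count_list M e + count_list C e = 0"
    using count_ribbon[of e] unfolding split by simp
  then have e: "e \<notin> set A" "e \<notin> set M" "e \<notin> set C"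
    by (auto simp: count_list_0_iff)
  have odd_iff: "odd (count_list M f) \<longleftrightarrow> interlaced G e f" if "f \<in> X" for f
  proof (cases "f = e")
    case True
    then show ?thesis
      using e by (simp add: interlaced_def)
  next
    case False
    have tot: "count_list A f + count_list M f + count_list C f = 2"
      using count_ribbon[of f] that X False unfolding split by auto
    have "filter (\<lambda>x. x = e \<or> x = f) (map fst R) =
        replicate (count_list A f) f @ e # replicate (count_list M f) f @ e #
        replicate (count_list C f) f"
      unfolding split using e by (simp add: filter_two_eq_replicate)
    \<comment> \<open>The six ways to place the two ends of \<open>f\<close>; only \<open>(1,1,0)\<close> and \<open>(0,1,1)\<close> alternate with \<open>e\<close>.\<close>
    moreover have "(count_list A f, count_list M f, count_list C f) \<in>
        {(2,0,0), (0,2,0), (0,0,2), (1,1,0), (1,0,1), (0,1,1)}"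
      using tot three_summands_of_two by blast
    ultimately show ?thesis
      using False by (auto simp: interlaced_def disc numeral_2_eq_2)
  qed
  have len: "length (filter (\<lambda>x. x \<in> X) ys) = (\<Sum>f\<in>X. count_list ys f)" for ys
  proof (induction ys)
    case (Cons y ys)
    have "(\<Sum>f\<in>X. count_list (y # ys) f) = (\<Sum>f\<in>X. count_list ys f + of_bool (f = y))"
      by (intro sum.cong) auto
    also have "\<dots> = (\<Sum>f\<in>X. count_list ys f) + of_bool (y \<in> X)"
      using finite_subset[OF X finite_ribbons] by (simp add: sum.distrib of_bool_def)
    finally show ?case
      using Cons by simp
  qed simp
  have "prefix_count X q = prefix_count X (Suc p) + length (filter (\<lambda>x. x \<in> X) M)"
    unfolding prefix_count_def M_def by (subst tq) (simp add: filter_map comp_def)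
  moreover have "odd (length (filter (\<lambda>x. x \<in> X) M)) \<longleftrightarrow> odd (card {f \<in> X. odd (count_list M f)})"
    unfolding len using finite_subset[OF X finite_ribbons] by (simp add: even_sum_iff)
  moreover have "{f \<in> X. odd (count_list M f)} = {f \<in> X. interlaced G e f}"
    using odd_iff by auto
  ultimately show ?thesis
    by auto
qed

text \<open>
  Either both ends of \<open>e\<close> are changes of colour or none is, so exchanging their roles alters both
  counts by the same amount and it does not matter which end comes first in the list.
\<close>

lemma odd_prefix_count_between:
  assumes X: "X \<subseteq> ribbons G" and pq: "p \<noteq> q" "p < length R" "q < length R"
    and p: "fst (R ! p) = e" and q: "fst (R ! q) = e"
  shows "odd (prefix_count X (Suc p)) \<noteq> odd (prefix_count X q) \<longleftrightarrow> odd (card {f \<in> X. interlaced G e f})"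
proof (cases "p < q")
  case True
  then show ?thesis
    using odd_prefix_count_between_less[OF X] pq p q by blast
next
  case False
  then have "odd (prefix_count X (Suc q)) \<noteq> odd (prefix_count X p) \<longleftrightarrow> odd (card {f \<in> X. interlaced G e f})"
    using odd_prefix_count_between_less[OF X, of q p e] pq p q by linarith
  then show ?thesis
    using pq p q by (auto simp: prefix_count_Suc)
qed

lemma vertex_arcs_nth:
  "vertex_arcs G = {((R ! p, True), (R ! (Suc p mod length R), False)) |p. p < length R}"
  unfolding vertex_arcs_def disc by auto

lemma colouring_arcs:
  assumes "X \<subseteq> ribbons G" "(x, y) \<in> vertex_arcs G"
  shows "x \<in> colouring b X \<longleftrightarrow> y \<in> colouring b X"
proof -
  obtain p where p: "p < length R" "x = (R ! p, True)" "y = (R ! (Suc p mod length R), False)"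
    using assms by (auto simp: vertex_arcs_nth)
  moreover have "Suc p mod length R < length R"
    using p by (auto intro: mod_less_divisor)
  moreover have "odd (prefix_count X (Suc p)) \<longleftrightarrow> odd (prefix_count X (Suc p mod length R))"
    using p even_prefix_count_all[OF assms(1)] by (cases "Suc p = length R") (auto simp: prefix_count_0)
  ultimately show ?thesis
    by (simp add: mem_colouring)
qed

text \<open>
  Merges the untwisted and the twisted case of the side relation into one equation.
\<close>

lemma saturated_sides_iff:
  "(\<forall>(x, y)\<in>ribbon_sides G. x \<in> S \<longleftrightarrow> y \<in> S) \<longleftrightarrow>
    (\<forall>e\<in>ribbons G. \<forall>s. ((e, False), s) \<in> S \<longleftrightarrow> ((e, True), s \<noteq> (e \<notin> twisted G)) \<in> S)"
proof -
  have "ribbon_sides G =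
      (\<lambda>(e, s). (((e, False), s), ((e, True), s \<noteq> (e \<notin> twisted G)))) ` (ribbons G \<times> UNIV)"
    by (force simp: ribbon_sides_def image_iff)
  then show ?thesis
    by simp
qed

text \<open>
  Row \<open>e\<close> of the kernel condition.  With \<open>e\<close> at positions \<open>p\<close> and \<open>q\<close>, an untwisted ribbon joins the
  corner after \<open>p\<close> to the corner before \<open>q\<close>, so the number of changes between them must be even.  A
  twisted ribbon joins the corners before \<open>p\<close> and before \<open>q\<close>, and then the change at \<open>p\<close> itself counts
  too: this is the diagonal entry.
\<close>

lemma colouring_sides_iff:
  assumes X: "X \<subseteq> ribbons G"
  shows "(\<forall>(x, y)\<in>ribbon_sides G. x \<in> colouring b X \<longleftrightarrow> y \<in> colouring b X) \<longleftrightarrow>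
    X \<in> parity_kernel G"
proof -
  let ?c = "colouring b X"
  have key: "(\<forall>s. ((e, False), s) \<in> ?c \<longleftrightarrow> ((e, True), s \<noteq> (e \<notin> twisted G)) \<in> ?c) \<longleftrightarrow>
    ((e \<in> X \<and> e \<in> twisted G) \<longleftrightarrow> odd (card {f \<in> X. interlaced G e f}))"
    if e: "e \<in> ribbons G" for e
  proof -
    obtain p q where p: "p < length R" "R ! p = (e, False)" and q: "q < length R" "R ! q = (e, True)"
      using half_edge_at[OF e, of False] half_edge_at[OF e, of True] by blast
    have "p \<noteq> q"
      using p q by auto
    then have btw: "odd (prefix_count X (Suc p)) \<noteq> odd (prefix_count X q) \<longleftrightarrow>
        odd (card {f \<in> X. interlaced G e f})"
      using odd_prefix_count_between[OF X, of p q e] p q by simp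
    have mem: "((e, False), s) \<in> ?c \<longleftrightarrow> (b \<noteq> odd (prefix_count X (if s then Suc p else p)))"
      "((e, True), s) \<in> ?c \<longleftrightarrow> (b \<noteq> odd (prefix_count X (if s then Suc q else q)))" for s
      using mem_colouring[OF p(1)] mem_colouring[OF q(1)] p q by simp_all
    have suc: "prefix_count X (Suc p) = prefix_count X p + of_bool (e \<in> X)" "prefix_count X (Suc q) = prefix_count X q + of_bool (e \<in> X)"
      using prefix_count_Suc p q by simp_all
    show ?thesis
      unfolding btw[symmetric] mem by (cases "e \<in> X") (auto simp: suc all_bool_eq)
  qed
  show ?thesis
    using key X by (simp add: saturated_sides_iff parity_kernel_def)
qed

lemma colouring_crosses:
  assumes "p < length R"
  shows "((R ! p, False) \<in> colouring b X) \<noteq> ((R ! p, True) \<in> colouring b X) \<longleftrightarrow> fst (R ! p) \<in> X"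
  using assms by (auto simp: mem_colouring prefix_count_Suc)

text \<open>
  If the two sides of a ribbon carry different colours then the colour changes at both of its ends,
  so a face colouring is recovered from its value at position 0 by walking round the disc.
\<close>

lemma saturated_imp_colouring:
  assumes S: "S \<subseteq> corners G"
    and closed: "\<forall>(x, y)\<in>vertex_arcs G \<union> ribbon_sides G. x \<in> S \<longleftrightarrow> y \<in> S"
  obtains b X where "X \<subseteq> ribbons G" "S = colouring b X"
proof
  \<comment> \<open>One end of each ribbon suffices here: \<open>cross\<close> shows that the colour changes at both or at neither.\<close>
  define X where "X = {e \<in> ribbons G. ((e, False), False) \<in> S \<longleftrightarrow> ((e, False), True) \<notin> S}"
  define b where "b \<longleftrightarrow> (R ! 0, False) \<in> S"
  show "X \<subseteq> ribbons G"
    by (auto simp: X_def)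
  have sides: "((e, False), s) \<in> S \<longleftrightarrow> ((e, True), s \<noteq> (e \<notin> twisted G)) \<in> S"
    if "e \<in> ribbons G" for e s
    using closed that saturated_sides_iff[of S] by blast
  have cross: "(R ! p, True) \<in> S \<longleftrightarrow> ((R ! p, False) \<in> S) \<noteq> (fst (R ! p) \<in> X)"
    if p: "p < length R" for p
  proof -
    obtain e t where et: "R ! p = (e, t)"
      by force
    then have e: "e \<in> ribbons G"
      using ribbon_at[OF p] by simp
    show ?thesis
      using e sides[OF e, of True] sides[OF e, of False]
      by (cases t; cases "e \<in> twisted G") (auto simp: et X_def)
  qed
  have lvl: "(R ! p, False) \<in> S \<longleftrightarrow> (b \<noteq> odd (prefix_count X p))" if "p < length R" for p
    using that
  proof (induction p)
    case 0
    then show ?case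
      by (simp add: b_def prefix_count_0)
  next
    case (Suc p)
    have "(R ! p, True) \<in> S \<longleftrightarrow> (R ! Suc p, False) \<in> S"
    proof -
      have "((R ! p, True), (R ! Suc p, False)) \<in> vertex_arcs G"
        using Suc.prems unfolding vertex_arcs_nth by (auto intro!: exI[of _ p])
      then show ?thesis
        using closed by blast
    qed
    then show ?case
      using Suc cross[of p] by (auto simp: prefix_count_Suc)
  qed
  have "(R ! p, s) \<in> S \<longleftrightarrow> (R ! p, s) \<in> colouring b X" if "p < length R" for p s
    using that lvl[OF that] cross[OF that] by (cases s) (auto simp: mem_colouring prefix_count_Suc)
  moreover have "colouring b X \<subseteq> corners G"
    by (auto simp: colouring_def corners_nth)
  ultimately show "S = colouring b X"
    using S unfolding corners_nth by blast
qed

text \<open>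
  Face colourings correspond to a starting colour together with a kernel vector; the starting colour
  gives the factor 2.
\<close>

lemma card_saturated_corner_sets:
  assumes ne: "ribbons G \<noteq> {}"
  shows "card {S. S \<subseteq> corners G \<and> (\<forall>(x, y)\<in>vertex_arcs G \<union> ribbon_sides G. x \<in> S \<longleftrightarrow> y \<in> S)}
    = 2 * card (parity_kernel G)"
proof -
  let ?Sat = "{S. S \<subseteq> corners G \<and> (\<forall>(x, y)\<in>vertex_arcs G \<union> ribbon_sides G. x \<in> S \<longleftrightarrow> y \<in> S)}"
  have R: "0 < length R"
    using R_nonempty[OF ne] by simp
  have "bij_betw (\<lambda>(b, X). colouring b X) (UNIV \<times> parity_kernel G) ?Sat"
  proof (rule bij_betw_imageI)
    show "inj_on (\<lambda>(b, X). colouring b X) (UNIV \<times> parity_kernel G)"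
    proof (rule inj_onI, clarify)
      fix b X b' X'
      assume X: "X \<in> parity_kernel G" "X' \<in> parity_kernel G" and eq: "colouring b X = colouring b' X'"
      have "e \<in> X \<longleftrightarrow> e \<in> X'" if "e \<in> ribbons G" for e
      proof -
        obtain p where "p < length R" "R ! p = (e, False)"
          using half_edge_at[of e False] \<open>e \<in> ribbons G\<close> by blast
        then show ?thesis
          using colouring_crosses[of p b X] colouring_crosses[of p b' X'] eq by simp
      qed
      moreover have "X \<subseteq> ribbons G" "X' \<subseteq> ribbons G"
        using X by (auto simp: parity_kernel_def)
      moreover have "b = b'"
        using mem_colouring[OF R, of False b X] mem_colouring[OF R, of False b' X'] eq
        by (simp add: prefix_count_0)
      ultimately show "b = b' \<and> X = X'"
        by blast
    qed
    show "(\<lambda>(b, X). colouring b X) ` (UNIV \<times> parity_kernel G) = ?Sat"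
    proof (intro equalityI subsetI)
      fix S assume "S \<in> (\<lambda>(b, X). colouring b X) ` (UNIV \<times> parity_kernel G)"
      then obtain b X where X: "X \<in> parity_kernel G" and S: "S = colouring b X"
        by auto
      have "X \<subseteq> ribbons G"
        using X by (simp add: parity_kernel_def)
      moreover have "S \<subseteq> corners G"
        by (auto simp: S colouring_def corners_nth)
      moreover have "\<forall>(x, y)\<in>vertex_arcs G \<union> ribbon_sides G. x \<in> S \<longleftrightarrow> y \<in> S"
        unfolding S ball_Un
        using X colouring_sides_iff[OF \<open>X \<subseteq> ribbons G\<close>] colouring_arcs[OF \<open>X \<subseteq> ribbons G\<close>] by blast
      ultimately show "S \<in> ?Sat"
        by (intro CollectI conjI)
    next
      fix S assume S: "S \<in> ?Sat"
      then have sub: "S \<subseteq> corners G"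
        and closed: "\<forall>(x, y)\<in>vertex_arcs G \<union> ribbon_sides G. x \<in> S \<longleftrightarrow> y \<in> S"
        by simp_all
      then obtain b X where X: "X \<subseteq> ribbons G" and eq: "S = colouring b X"
        by (rule saturated_imp_colouring)
      have "X \<in> parity_kernel G"
        using closed colouring_sides_iff[OF X, of b] unfolding eq ball_Un by simp
      then show "S \<in> (\<lambda>(b, X). colouring b X) ` (UNIV \<times> parity_kernel G)"
        by (auto simp: eq)
    qed
  qed
  then show ?thesis
    by (simp add: bij_betw_same_card[symmetric] card_cartesian_product)
qed

lemma euler_genus_eq_corank:
  assumes ne: "ribbons G \<noteq> {}" and ker: "card (parity_kernel G) = 2 ^ \<nu>"
  shows "euler_genus G = int (card (ribbons G)) - int \<nu>"
proof -
  let ?r = "vertex_arcs G \<union> ribbon_sides G"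
  have "?r \<subseteq> corners G \<times> corners G"
  proof -
    have "vertex_arcs G \<subseteq> corners G \<times> corners G"
      by (auto simp: vertex_arcs_nth corners_nth intro!: exI mod_less_divisor)
    moreover have "ribbon_sides G \<subseteq> corners G \<times> corners G"
      by (auto simp: ribbon_sides_def corners_def half_edges_def)
    ultimately show ?thesis
      by blast
  qed
  moreover have "finite (corners G)"
    using finite_ribbons by (simp add: corners_def half_edges_def)
  ultimately have "2 ^ card (corners G // (?r \<union> ?r\<inverse>)\<^sup>*) = 2 * card (parity_kernel G)"
    using card_saturated_sets[of "corners G" ?r] card_saturated_corner_sets[OF ne] by simp
  also have "?r \<union> ?r\<inverse> = vertex_arcs G \<union> (vertex_arcs G)\<inverse> \<union> ribbon_sides G \<union> (ribbon_sides G)\<inverse>"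
    by auto
  finally have "2 ^ card (corners G // boundary_joined G) = (2::nat) ^ Suc \<nu>"
    by (simp add: boundary_joined_def ker)
  then have "card (corners G // boundary_joined G) = Suc \<nu>"
    by (simp only: power_inject_exp)
  moreover have "{w \<in> vertex_discs G. rotation G w = []} = {}"
    using R_nonempty[OF ne] disc by auto
  ultimately have "card (faces G) = Suc \<nu>"
    by (simp only: faces_def Plus_def image_empty Un_empty_right) (simp add: card_image)
  moreover have "card (components G) = 1"
    by (simp add: components_def disc quotient_def)
  ultimately show ?thesis
    by (simp add: euler_genus_def disc)
qed

end

section \<open>The parity kernel of a complete tripartite graph\<close>

text \<open>
  The restrictions to one part \<open>P\<close> of the kernel vectors: \<open>c\<close> is the parity of the vector on the other
  two parts, which enters every row of \<open>P\<close> in the same way, and \<open>s\<close> is its parity on \<open>P\<close>.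
\<close>

definition part_solutions :: "'e set \<Rightarrow> 'e set \<Rightarrow> bool \<Rightarrow> bool \<Rightarrow> 'e set set" where
  "part_solutions P T c s =
     {Y. Y \<subseteq> P \<and> (\<forall>e\<in>P. (e \<in> Y \<and> e \<in> T) \<longleftrightarrow> c) \<and> (odd (card Y) \<longleftrightarrow> s)}"

definition tripartite_kernel :: "'e set \<Rightarrow> 'e set \<Rightarrow> 'e set \<Rightarrow> 'e set \<Rightarrow> 'e set set" where
  "tripartite_kernel U V W T = {X. X \<subseteq> U \<union> V \<union> W \<and>
     (\<forall>e\<in>U. (e \<in> X \<and> e \<in> T) \<longleftrightarrow> odd (card (X \<inter> V) + card (X \<inter> W))) \<and>
     (\<forall>e\<in>V. (e \<in> X \<and> e \<in> T) \<longleftrightarrow> odd (card (X \<inter> U) + card (X \<inter> W))) \<and>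
     (\<forall>e\<in>W. (e \<in> X \<and> e \<in> T) \<longleftrightarrow> odd (card (X \<inter> U) + card (X \<inter> V)))}"

definition tripartite_nullity :: "'e set \<Rightarrow> 'e set \<Rightarrow> 'e set \<Rightarrow> 'e set \<Rightarrow> nat" where
  "tripartite_nullity U V W T =
     (if U \<union> V \<union> W \<subseteq> T then num_odd (card U) (card V) (card W) - 1
      else if V \<union> W \<subseteq> T then card (U - T) - of_bool (odd (card V + card W))
      else if U \<union> W \<subseteq> T then card (V - T) - of_bool (odd (card U + card W))
      else if U \<union> V \<subseteq> T then card (W - T) - of_bool (odd (card U + card V))
      else card (U \<union> V \<union> W - T) - 2)"

text \<open>
  Adding or not adding one fixed element adjusts the parity of any subset of the rest.
\<close>

lemma card_subsets_of_parity:
  assumes "finite Z" "Z \<noteq> {}"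
  shows "card {Y. Y \<subseteq> Z \<and> (odd (card Y) \<longleftrightarrow> s)} = 2 ^ (card Z - 1)"
proof -
  obtain z where z: "z \<in> Z"
    using assms by auto
  let ?f = "\<lambda>Y. if odd (card Y) \<longleftrightarrow> s then Y else insert z Y"
  have "bij_betw ?f (Pow (Z - {z})) {Y. Y \<subseteq> Z \<and> (odd (card Y) \<longleftrightarrow> s)}"
  proof (rule bij_betw_byWitness[where f' = "\<lambda>Y. Y - {z}"])
    show "\<forall>Y\<in>Pow (Z - {z}). ?f Y - {z} = Y"
      by auto
    show "\<forall>Y\<in>{Y. Y \<subseteq> Z \<and> (odd (card Y) \<longleftrightarrow> s)}. ?f (Y - {z}) = Y"
    proof
      fix Y assume Y: "Y \<in> {Y. Y \<subseteq> Z \<and> (odd (card Y) \<longleftrightarrow> s)}"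
      then have "finite Y"
        using assms finite_subset by blast
      then show "?f (Y - {z}) = Y"
        using card.remove[of Y z] Y by (cases "z \<in> Y") auto
    qed
    show "?f ` Pow (Z - {z}) \<subseteq> {Y. Y \<subseteq> Z \<and> (odd (card Y) \<longleftrightarrow> s)}"
    proof clarify
      fix Y assume Y: "Y \<subseteq> Z - {z}"
      then have "card (insert z Y) = Suc (card Y)"
        using assms finite_subset[of Y Z] by (subst card_insert_disjoint) auto
      then show "?f Y \<subseteq> Z \<and> (odd (card (?f Y)) \<longleftrightarrow> s)"
        using Y z by auto
    qed
  qed auto
  then have "card {Y. Y \<subseteq> Z \<and> (odd (card Y) \<longleftrightarrow> s)} = card (Pow (Z - {z}))"
    by (simp add: bij_betw_same_card)
  then show ?thesis
    using assms z by (simp add: card_Pow)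
qed

text \<open>
  When every diagonal entry of the part is 1, each row reads \<open>(e \<in> Y) = c\<close> and leaves no freedom.
\<close>

lemma card_part_solutions_full:
  assumes "P \<subseteq> T"
  shows "card (part_solutions P T c s) = of_bool (s \<longleftrightarrow> c \<and> odd (card P))"
proof -
  have "Y \<subseteq> P \<and> (\<forall>e\<in>P. (e \<in> Y \<and> e \<in> T) \<longleftrightarrow> c) \<longleftrightarrow> Y = (if c then P else {})" for Y
    using assms by (cases c) auto
  then have "part_solutions P T c s = {Y. Y = (if c then P else {}) \<and> (odd (card Y) \<longleftrightarrow> s)}"
    unfolding part_solutions_def by blast
  also have "\<dots> = (if s \<longleftrightarrow> c \<and> odd (card P) then {if c then P else {}} else {})"
    by auto
  finally show ?thesis
    by simp
qed

text \<open>
  A row with diagonal entry 0 forces \<open>c\<close> to vanish.  Then the rows with entry 1 remove the elements of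
  \<open>T\<close>, while those outside \<open>T\<close> are free up to parity.
\<close>

lemma card_part_solutions_not_full:
  assumes "finite P" "\<not> P \<subseteq> T"
  shows "card (part_solutions P T c s) = (if c then 0 else 2 ^ (card (P - T) - 1))"
proof (cases c)
  case True
  then have "part_solutions P T c s = {}"
    using assms by (auto simp: part_solutions_def)
  then show ?thesis
    using True by simp
next
  case False
  then have "part_solutions P T c s = {Y. Y \<subseteq> P - T \<and> (odd (card Y) \<longleftrightarrow> s)}"
    by (auto simp: part_solutions_def)
  then show ?thesis
    using False assms by (simp add: card_subsets_of_parity)
qed

context
  fixes U V W :: "'e set"
  assumes fin: "finite U" "finite V" "finite W"
    and disj: "U \<inter> V = {}" "U \<inter> W = {}" "V \<inter> W = {}"
begin

text \<open>
  Once the parities \<open>a\<close>, \<open>b\<close>, \<open>c\<close> of the vector on the three parts are fixed, the rows of different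
  parts no longer interact.
\<close>

lemma card_tripartite_kernel_eq_sum:
  "card (tripartite_kernel U V W T) = (\<Sum>a\<in>UNIV. \<Sum>b\<in>UNIV. \<Sum>c\<in>UNIV.
     card (part_solutions U T (b \<noteq> c) a) * card (part_solutions V T (a \<noteq> c) b) *
     card (part_solutions W T (a \<noteq> b) c))"
proof -
  let ?S = "\<lambda>(a, b, c). part_solutions U T (b \<noteq> c) a \<times> part_solutions V T (a \<noteq> c) b \<times>
    part_solutions W T (a \<noteq> b) c"
  have cap: "(X \<union> Y \<union> Z) \<inter> U = X" "(X \<union> Y \<union> Z) \<inter> V = Y" "(X \<union> Y \<union> Z) \<inter> W = Z"
    if "X \<subseteq> U" "Y \<subseteq> V" "Z \<subseteq> W" for X Y Z
    using that disj by blast+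
  have "bij_betw (\<lambda>X. (X \<inter> U, X \<inter> V, X \<inter> W)) (tripartite_kernel U V W T) (\<Union>p\<in>UNIV. ?S p)"
  proof (rule bij_betw_byWitness[where f' = "\<lambda>(X, Y, Z). X \<union> Y \<union> Z"])
    show "\<forall>X\<in>tripartite_kernel U V W T. (case (X \<inter> U, X \<inter> V, X \<inter> W) of (X, Y, Z) \<Rightarrow> X \<union> Y \<union> Z) = X"
      by (auto simp: tripartite_kernel_def)
    show "\<forall>p\<in>\<Union>p\<in>UNIV. ?S p. ((case p of (X, Y, Z) \<Rightarrow> X \<union> Y \<union> Z) \<inter> U,
        (case p of (X, Y, Z) \<Rightarrow> X \<union> Y \<union> Z) \<inter> V, (case p of (X, Y, Z) \<Rightarrow> X \<union> Y \<union> Z) \<inter> W) = p"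
      using cap by (auto simp: part_solutions_def)
    show "(\<lambda>X. (X \<inter> U, X \<inter> V, X \<inter> W)) ` tripartite_kernel U V W T \<subseteq> (\<Union>p\<in>UNIV. ?S p)"
    proof clarify
      fix X assume X: "X \<in> tripartite_kernel U V W T"
      have "(X \<inter> U, X \<inter> V, X \<inter> W) \<in>
          ?S (odd (card (X \<inter> U)), odd (card (X \<inter> V)), odd (card (X \<inter> W)))"
        using X by (auto simp: tripartite_kernel_def part_solutions_def)
      then show "(X \<inter> U, X \<inter> V, X \<inter> W) \<in> (\<Union>p\<in>UNIV. ?S p)"
        by blast
    qed
    show "(\<lambda>(X, Y, Z). X \<union> Y \<union> Z) ` (\<Union>p\<in>UNIV. ?S p) \<subseteq> tripartite_kernel U V W T"
    proof clarify
      fix X Y Z a b c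
      assume *: "X \<in> part_solutions U T (b \<noteq> c) a" "Y \<in> part_solutions V T (a \<noteq> c) b"
        "Z \<in> part_solutions W T (a \<noteq> b) c"
      then have sub: "X \<subseteq> U" "Y \<subseteq> V" "Z \<subseteq> W"
        by (auto simp: part_solutions_def)
      have mem: "e \<in> X \<union> Y \<union> Z \<longleftrightarrow> e \<in> X" if "e \<in> U" for e
        using that sub disj by blast
      have mem': "e \<in> X \<union> Y \<union> Z \<longleftrightarrow> e \<in> Y" if "e \<in> V" for e
        using that disj sub by blast
      have mem'': "e \<in> X \<union> Y \<union> Z \<longleftrightarrow> e \<in> Z" if "e \<in> W" for e
        using that disj sub by blast
      have "X \<union> Y \<union> Z \<subseteq> U \<union> V \<union> W"
        using sub by blast
      then show "X \<union> Y \<union> Z \<in> tripartite_kernel U V W T"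
        using * unfolding tripartite_kernel_def mem_Collect_eq cap[OF sub]
        by (simp add: part_solutions_def mem mem' mem'' del: Un_iff Un_subset_iff) blast
    qed
  qed
  then have "card (tripartite_kernel U V W T) = card (\<Union>p\<in>UNIV. ?S p)"
    by (rule bij_betw_same_card)
  also have "\<dots> = (\<Sum>p\<in>UNIV. card (?S p))"
  proof (rule card_UN_disjoint)
    have "finite (part_solutions P T c s)" if "finite P" for P :: "'e set" and c s
      using that by (auto simp: part_solutions_def intro: finite_subset[of _ "Pow P"])
    then show "\<forall>p\<in>UNIV. finite (?S p)"
      using fin by auto
    show "\<forall>p\<in>UNIV. \<forall>q\<in>UNIV. p \<noteq> q \<longrightarrow> ?S p \<inter> ?S q = {}"
      by (auto simp: part_solutions_def)
  qed simp
  also have "\<dots> = (\<Sum>a\<in>UNIV. \<Sum>b\<in>UNIV. \<Sum>c\<in>UNIV. card (?S (a, b, c)))"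
    by (simp add: UNIV_Times_UNIV[symmetric] sum.cartesian_product split_def del: UNIV_Times_UNIV)
  finally show ?thesis
    by (simp add: card_cartesian_product mult.assoc)
qed

text \<open>
  Of the eight parity patterns, a part not inside \<open>T\<close> admits only those with equal parities on the
  other two, and a part inside \<open>T\<close> only those solving one linear equation.  The surviving patterns
  contribute equally, and their number is a power of 2.
\<close>

lemma card_tripartite_kernel:
  "card (tripartite_kernel U V W T) = 2 ^ tripartite_nullity U V W T"
proof -
  let ?z = "\<lambda>P. card (P - T)"
  have pos: "\<exists>m. ?z P = Suc m" if "finite P" "\<not> P \<subseteq> T" for P
    using that by (metis Diff_eq_empty_iff card_eq_0_iff finite_Diff not0_implies_Suc)
  have z: "card (U \<union> V \<union> W - T) = ?z U + ?z V + ?z W"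
  proof -
    have "U \<union> V \<union> W - T = (U - T) \<union> (V - T) \<union> (W - T)"
      by auto
    also have "card \<dots> = ?z U + ?z V + ?z W"
      using fin disj by (subst card_Un_disjoint; (subst card_Un_disjoint)?) auto
    finally show ?thesis .
  qed
  have z0: "?z P = 0" if "P \<subseteq> T" for P
    using that by (simp add: Diff_eq_empty_iff[THEN iffD2])
  note expand = card_tripartite_kernel_eq_sum tripartite_nullity_def UNIV_bool
    card_part_solutions_full card_part_solutions_not_full fin z
  consider "U \<subseteq> T" "V \<subseteq> T" "W \<subseteq> T"
    | "\<not> U \<subseteq> T" "V \<subseteq> T" "W \<subseteq> T" | "U \<subseteq> T" "\<not> V \<subseteq> T" "W \<subseteq> T" | "U \<subseteq> T" "V \<subseteq> T" "\<not> W \<subseteq> T"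
    | "\<not> U \<subseteq> T" "\<not> V \<subseteq> T" "W \<subseteq> T" | "\<not> U \<subseteq> T" "V \<subseteq> T" "\<not> W \<subseteq> T" | "U \<subseteq> T" "\<not> V \<subseteq> T" "\<not> W \<subseteq> T"
    | "\<not> U \<subseteq> T" "\<not> V \<subseteq> T" "\<not> W \<subseteq> T"
    by blast
  then show ?thesis
  proof cases
    case 1
    then show ?thesis
      by (cases "odd (card U)"; cases "odd (card V)"; cases "odd (card W)")
        (simp_all add: expand num_odd_def)
  next
    case 2
    with pos[OF fin(1)] obtain m where "?z U = Suc m" by auto
    with 2 show ?thesis
      by (cases "odd (card V)"; cases "odd (card W)") (simp_all add: expand)
  next
    case 3
    with pos[OF fin(2)] obtain m where "?z V = Suc m" by auto
    with 3 show ?thesis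
      by (cases "odd (card U)"; cases "odd (card W)") (simp_all add: expand)
  next
    case 4
    with pos[OF fin(3)] obtain m where "?z W = Suc m" by auto
    with 4 show ?thesis
      by (cases "odd (card U)"; cases "odd (card V)") (simp_all add: expand)
  next
    case 5
    with pos[OF fin(1)] pos[OF fin(2)] obtain m n where "?z U = Suc m" "?z V = Suc n" by auto
    with 5 show ?thesis
      by (simp add: expand z0 power_add)
  next
    case 6
    with pos[OF fin(1)] pos[OF fin(3)] obtain m n where "?z U = Suc m" "?z W = Suc n" by auto
    with 6 show ?thesis
      by (simp add: expand z0 power_add)
  next
    case 7
    with pos[OF fin(2)] pos[OF fin(3)] obtain m n where "?z V = Suc m" "?z W = Suc n" by auto
    with 7 show ?thesis
      by (simp add: expand z0 power_add)
  next
    case 8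
    with pos[OF fin(1)] pos[OF fin(2)] pos[OF fin(3)] obtain l m n
      where "?z U = Suc l" "?z V = Suc m" "?z W = Suc n" by auto
    with 8 show ?thesis
      by (simp add: expand power_add)
  qed
qed

end

section \<open>Counting twist sets by rank\<close>

lemma card_subsets_of_size:
  assumes "finite P" "P \<noteq> {}"
  shows "card {A. A \<subseteq> P \<and> int (card A) = r} = binom (card P) r"
proof (cases "r < 0")
  case True
  then have "{A. A \<subseteq> P \<and> int (card A) = r} = {}"
    by auto
  then show ?thesis
    using True by (simp only: card.empty binom_def) simp
next
  case False
  then have "{A. A \<subseteq> P \<and> int (card A) = r} = {A. A \<subseteq> P \<and> card A = nat r}"
    by auto
  then show ?thesis
    using False assms by (auto simp: binom_def n_subsets binomial_eq_0)
qed

text \<open>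
  Sizes are taken as integers because \<open>binom\<close> and the ranges of summation in \<open>g\<close> are.
\<close>

lemma sum_subsets_by_size:
  fixes F :: "int \<Rightarrow> nat"
  assumes "finite P" "P \<noteq> {}" "finite Q"
  shows "(\<Sum>A | A \<subseteq> P \<and> int (card A) \<in> Q. F (int (card A))) = (\<Sum>a\<in>Q. binom (card P) a * F a)"
proof -
  let ?S = "{A. A \<subseteq> P \<and> int (card A) \<in> Q}"
  have "finite ?S"
    using assms by (auto intro: finite_subset[of _ "Pow P"])
  then have "(\<Sum>A\<in>?S. F (int (card A))) =
      (\<Sum>a\<in>Q. \<Sum>A | A \<in> ?S \<and> int (card A) = a. F (int (card A)))"
    using assms by (intro sum.group[symmetric]) auto
  also have "\<dots> = (\<Sum>a\<in>Q. binom (card P) a * F a)"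
  proof (rule sum.cong)
    fix a assume "a \<in> Q"
    then have "{A. A \<in> ?S \<and> int (card A) = a} = {A. A \<subseteq> P \<and> int (card A) = a}"
      by auto
    then show "(\<Sum>A | A \<in> ?S \<and> int (card A) = a. F (int (card A))) = binom (card P) a * F a"
      using assms by (simp add: card_subsets_of_size)
  qed simp
  finally show ?thesis .
qed

lemma sum_Pow_by_size:
  fixes F :: "int \<Rightarrow> nat"
  assumes "finite P" "P \<noteq> {}"
  shows "(\<Sum>A\<in>Pow P. F (int (card A))) = (\<Sum>a = 0..int (card P). binom (card P) a * F a)"
proof -
  have "Pow P = {A. A \<subseteq> P \<and> int (card A) \<in> {0..int (card P)}}"
    using assms by (auto intro: card_mono)
  then show ?thesis
    by (simp only: sum_subsets_by_size[OF assms finite_atLeastAtMost_int])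
qed

lemma sum_psubsets_by_size:
  fixes F :: "int \<Rightarrow> nat"
  assumes "finite P" "P \<noteq> {}"
  shows "(\<Sum>A | A \<subset> P. F (int (card A))) = (\<Sum>a = 0..int (card P) - 1. binom (card P) a * F a)"
proof -
  have "A \<subset> P \<longleftrightarrow> A \<subseteq> P \<and> card A < card P" for A
    using psubset_card_mono[OF assms(1), of A] by auto
  then have "{A. A \<subset> P} = {A. A \<subseteq> P \<and> int (card A) \<in> {0..int (card P) - 1}}"
    by auto
  then show ?thesis
    by (simp only: sum_subsets_by_size[OF assms finite_atLeastAtMost_int])
qed

lemma sum_psubsets_of_size:
  assumes "finite P"
  shows "(\<Sum>A | A \<subset> P. of_bool (int (card A) = r)) = binom_bar (card P) r"
proof (cases "P = {}")
  case False
  have "(\<Sum>A | A \<subset> P. of_bool (int (card A) = r)) =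
      (\<Sum>a = 0..int (card P) - 1. binom (card P) a * of_bool (a = r))"
    by (rule sum_psubsets_by_size[OF assms False])
  also have "\<dots> = (\<Sum>a = 0..int (card P) - 1. if r = a then binom (card P) r else 0)"
    by (intro sum.cong) auto
  finally show ?thesis
    by (simp add: binom_bar_def)
qed (simp add: binom_bar_def)

lemma sum_Pow_split:
  fixes h :: "'a set \<Rightarrow> nat"
  assumes "finite P"
  shows "sum h (Pow P) = h P + (\<Sum>A | A \<subset> P. h A)"
proof -
  have "Pow P = insert P {A. A \<subset> P}"
    by auto
  moreover have "finite {A. A \<subset> P}"
    using assms by (auto intro: finite_subset[of _ "Pow P"])
  ultimately show ?thesis
    by simp
qed

lemma sum_monom_fibres:
  assumes "finite X" "finite D" "\<gamma> ` X \<subseteq> D"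
  shows "(\<Sum>x\<in>X. monom 1 (\<gamma> x)) = (\<Sum>d\<in>D. monom (int (card {x \<in> X. \<gamma> x = d})) d)"
proof -
  have "(\<Sum>x\<in>X. monom (1::int) (\<gamma> x)) = (\<Sum>d\<in>D. \<Sum>x | x \<in> X \<and> \<gamma> x = d. monom 1 (\<gamma> x))"
    using assms by (intro sum.group[symmetric])
  also have "\<dots> = (\<Sum>d\<in>D. monom (int (card {x \<in> X. \<gamma> x = d})) d)"
    by (intro sum.cong) (simp_all add: of_nat_monom mult_monom)
  finally show ?thesis .
qed

lemma twice_ceiling_half: "2 * \<lceil>real m / 2\<rceil> = int m + of_bool (odd m)"
proof (cases "even m")
  case True
  then show ?thesis
    by (auto elim!: evenE)
next
  case False
  then obtain l where m: "m = 2 * l + 1"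
    by (auto elim!: oddE)
  have "\<lceil>real m / 2\<rceil> = int l + 1"
    by (intro ceiling_unique) (auto simp: m)
  then show ?thesis
    by (simp add: m)
qed

text \<open>
  The rank minus \<open>card T\<close>, for a set \<open>T\<close> that misses at least one loop.
\<close>

definition rank_excess :: "'e set \<Rightarrow> 'e set \<Rightarrow> 'e set \<Rightarrow> 'e set \<Rightarrow> nat" where
  "rank_excess U V W T =
     (if V \<union> W \<subseteq> T then of_bool (odd (card V + card W))
      else if U \<union> W \<subseteq> T then of_bool (odd (card U + card W))
      else if U \<union> V \<subseteq> T then of_bool (odd (card U + card V))
      else 2)"

context
  fixes U V W :: "'e set"
  assumes fin: "finite U" "finite V" "finite W"
    and disj: "U \<inter> V = {}" "U \<inter> W = {}" "V \<inter> W = {}"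
begin

lemma sum_Pow_three_parts:
  fixes F :: "'e set \<Rightarrow> nat"
  shows "sum F (Pow (U \<union> V \<union> W)) = (\<Sum>A\<in>Pow U. \<Sum>B\<in>Pow V. \<Sum>C\<in>Pow W. F (A \<union> B \<union> C))"
proof -
  have "bij_betw (\<lambda>(A, B, C). A \<union> B \<union> C) (Pow U \<times> Pow V \<times> Pow W) (Pow (U \<union> V \<union> W))"
  proof (rule bij_betw_byWitness[where f' = "\<lambda>T. (T \<inter> U, T \<inter> V, T \<inter> W)"])
    have "(A \<union> B \<union> C) \<inter> U = A \<and> (A \<union> B \<union> C) \<inter> V = B \<and> (A \<union> B \<union> C) \<inter> W = C"
      if "A \<subseteq> U" "B \<subseteq> V" "C \<subseteq> W" for A B C
      using that disj by blast
    then show "\<forall>p\<in>Pow U \<times> Pow V \<times> Pow W.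
        ((case p of (A, B, C) \<Rightarrow> A \<union> B \<union> C) \<inter> U, (case p of (A, B, C) \<Rightarrow> A \<union> B \<union> C) \<inter> V,
         (case p of (A, B, C) \<Rightarrow> A \<union> B \<union> C) \<inter> W) = p"
      by auto
  qed auto
  then have "sum F (Pow (U \<union> V \<union> W)) = (\<Sum>(A, B, C)\<in>Pow U \<times> Pow V \<times> Pow W. F (A \<union> B \<union> C))"
    by (simp add: sum.reindex_bij_betw[symmetric] case_prod_unfold)
  then show ?thesis
    by (simp add: sum.cartesian_product)
qed

text \<open>
  A set \<open>T\<close> is split into its traces \<open>A\<close>, \<open>B\<close>, \<open>C\<close> on the parts, and each trace is either the whole part
  or a proper subset.  Apart from \<open>T\<close> being everything, this leaves seven kinds.  Five of them are
  summands of \<open>g\<close> by themselves.  The other two are those where \<open>B\<close> and \<open>C\<close> are both proper; there the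
  excess is 2 whatever \<open>A\<close> is, and they make up the last summand, whose range for \<open>a\<close> therefore
  includes \<open>i\<close>.
\<close>

lemma count_by_rank:
  assumes ne: "U \<noteq> {}" "V \<noteq> {}"
  shows "card {T \<in> Pow (U \<union> V \<union> W) - {U \<union> V \<union> W}. card T + rank_excess U V W T = d} =
    g (card U) (card V) (card W) d"
proof -
  define F where "F = (\<lambda>T. of_bool (T \<noteq> U \<union> V \<union> W \<and> card T + rank_excess U V W T = d) :: nat)"
  define i where "i = card U" define j where "j = card V" define k where "k = card W"
  let ?h = "\<lambda>A B C. F (A \<union> B \<union> C)"
  have cardU: "card (A \<union> B \<union> C) = card A + card B + card C" if "A \<subseteq> U" "B \<subseteq> V" "C \<subseteq> W" for A B C
  proof -
    have "finite A" "finite B" "finite C"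
      using that fin finite_subset by blast+
    moreover have "A \<inter> B = {}" "(A \<union> B) \<inter> C = {}"
      using that disj by blast+
    ultimately show ?thesis
      by (simp add: card_Un_disjoint)
  qed
  have full: "V \<subseteq> A \<union> B \<union> C \<longleftrightarrow> B = V" "U \<subseteq> A \<union> B \<union> C \<longleftrightarrow> A = U" "W \<subseteq> A \<union> B \<union> C \<longleftrightarrow> C = W"
    "A \<union> B \<union> C = U \<union> V \<union> W \<longleftrightarrow> A = U \<and> B = V \<and> C = W"
    if "A \<subseteq> U" "B \<subseteq> V" "C \<subseteq> W" for A B C
    using that disj by blast+
  have h: "?h A B C = (if A = U \<and> B = V \<and> C = W then 0 else of_bool
      (int (card A) + int (card B) + int (card C) +
        (if B = V \<and> C = W then of_bool (odd (j + k)) else if A = U \<and> C = W then of_bool (odd (i + k))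
         else if A = U \<and> B = V then of_bool (odd (i + j)) else 2) = int d))"
    if "A \<subseteq> U" "B \<subseteq> V" "C \<subseteq> W" for A B C
    unfolding F_def rank_excess_def Un_subset_iff full[OF that] cardU[OF that] i_def j_def k_def
    by (auto simp: of_bool_def)
  have t6: "(\<Sum>A\<in>Pow U. \<Sum>B | B \<subset> V. \<Sum>C | C \<subset> W. ?h A B C) =
      (\<Sum>a = 0..int i. \<Sum>b = 0..int j - 1. binom i a * binom j b * binom_bar k (int d - 2 - a - b))"
  proof -
    have "(\<Sum>A\<in>Pow U. \<Sum>B | B \<subset> V. \<Sum>C | C \<subset> W. ?h A B C) =
        (\<Sum>A\<in>Pow U. \<Sum>B | B \<subset> V. \<Sum>C | C \<subset> W. of_bool (int (card C) = int d - 2 - int (card A) - int (card B)))"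
      by (intro sum.cong refl, subst h) (auto simp: of_bool_def)
    also have "\<dots> = (\<Sum>A\<in>Pow U. \<Sum>B | B \<subset> V. binom_bar k (int d - 2 - int (card A) - int (card B)))"
      by (simp only: sum_psubsets_of_size[OF fin(3)] k_def)
    also have "\<dots> = (\<Sum>A\<in>Pow U. \<Sum>b = 0..int j - 1. binom j b * binom_bar k (int d - 2 - int (card A) - b))"
      by (simp only: sum_psubsets_by_size[OF fin(2) ne(2), where F = "\<lambda>b. binom_bar k (int d - 2 - _ - b)"] j_def)
    also have "\<dots> = (\<Sum>a = 0..int i. binom i a * (\<Sum>b = 0..int j - 1. binom j b * binom_bar k (int d - 2 - a - b)))"
      unfolding i_def by (rule sum_Pow_by_size[OF fin(1) ne(1)])
    finally show ?thesis
      by (simp add: sum_distrib_left mult.assoc)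
  qed
  have t4: "(\<Sum>A | A \<subset> U. \<Sum>B | B \<subset> V. ?h A B W) =
      (\<Sum>a = 0..int i - 1. binom i a * binom_bar j (int d - 2 - int k - a))"
  proof -
    have "(\<Sum>A | A \<subset> U. \<Sum>B | B \<subset> V. ?h A B W) =
        (\<Sum>A | A \<subset> U. \<Sum>B | B \<subset> V. of_bool (int (card B) = int d - 2 - int k - int (card A)))"
      by (intro sum.cong refl, subst h) (auto simp: of_bool_def k_def)
    also have "\<dots> = (\<Sum>A | A \<subset> U. binom_bar j (int d - 2 - int k - int (card A)))"
      by (simp only: sum_psubsets_of_size[OF fin(2)] j_def)
    also have "\<dots> = (\<Sum>a = 0..int i - 1. binom i a * binom_bar j (int d - 2 - int k - a))"
      unfolding i_def by (rule sum_psubsets_by_size[OF fin(1) ne(1)])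
    finally show ?thesis .
  qed
  have t5: "(\<Sum>A | A \<subset> U. \<Sum>C | C \<subset> W. ?h A V C) =
      (\<Sum>a = 0..int i - 1. binom i a * binom_bar k (int d - 2 - int j - a))"
  proof -
    have "(\<Sum>A | A \<subset> U. \<Sum>C | C \<subset> W. ?h A V C) =
        (\<Sum>A | A \<subset> U. \<Sum>C | C \<subset> W. of_bool (int (card C) = int d - 2 - int j - int (card A)))"
      by (intro sum.cong refl, subst h) (auto simp: of_bool_def j_def)
    also have "\<dots> = (\<Sum>A | A \<subset> U. binom_bar k (int d - 2 - int j - int (card A)))"
      by (simp only: sum_psubsets_of_size[OF fin(3)] k_def)
    also have "\<dots> = (\<Sum>a = 0..int i - 1. binom i a * binom_bar k (int d - 2 - int j - a))"
      unfolding i_def by (rule sum_psubsets_by_size[OF fin(1) ne(1)])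
    finally show ?thesis .
  qed
  have t1: "(\<Sum>A | A \<subset> U. ?h A V W) = binom_bar i (int d - 2 * \<lceil>real (j + k) / 2\<rceil>)"
  proof -
    have "(\<Sum>A | A \<subset> U. ?h A V W) =
        (\<Sum>A | A \<subset> U. of_bool (int (card A) = int d - 2 * \<lceil>real (j + k) / 2\<rceil>))"
      unfolding twice_ceiling_half
      by (intro sum.cong refl, subst h) (auto simp: of_bool_def j_def k_def)
    then show ?thesis
      by (simp only: sum_psubsets_of_size[OF fin(1)] i_def)
  qed
  have t2: "(\<Sum>B | B \<subset> V. ?h U B W) = binom_bar j (int d - 2 * \<lceil>real (i + k) / 2\<rceil>)"
  proof -
    have "(\<Sum>B | B \<subset> V. ?h U B W) =
        (\<Sum>B | B \<subset> V. of_bool (int (card B) = int d - 2 * \<lceil>real (i + k) / 2\<rceil>))"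
      unfolding twice_ceiling_half
      by (intro sum.cong refl, subst h) (auto simp: of_bool_def i_def k_def)
    then show ?thesis
      by (simp only: sum_psubsets_of_size[OF fin(2)] j_def)
  qed
  have t3: "(\<Sum>C | C \<subset> W. ?h U V C) = binom_bar k (int d - 2 * \<lceil>real (i + j) / 2\<rceil>)"
  proof -
    have "(\<Sum>C | C \<subset> W. ?h U V C) =
        (\<Sum>C | C \<subset> W. of_bool (int (card C) = int d - 2 * \<lceil>real (i + j) / 2\<rceil>))"
      unfolding twice_ceiling_half
      by (intro sum.cong refl, subst h) (auto simp: of_bool_def i_def j_def)
    then show ?thesis
      by (simp only: sum_psubsets_of_size[OF fin(3)] k_def)
  qed
  have "card {T \<in> Pow (U \<union> V \<union> W) - {U \<union> V \<union> W}. card T + rank_excess U V W T = d} =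
      sum F (Pow (U \<union> V \<union> W))"
  proof -
    have "sum F (Pow (U \<union> V \<union> W)) = card (Pow (U \<union> V \<union> W) \<inter>
        {T. T \<noteq> U \<union> V \<union> W \<and> card T + rank_excess U V W T = d})"
      unfolding F_def using fin by (subst sum_of_bool_eq) auto
    also have "Pow (U \<union> V \<union> W) \<inter> {T. T \<noteq> U \<union> V \<union> W \<and> card T + rank_excess U V W T = d} =
        {T \<in> Pow (U \<union> V \<union> W) - {U \<union> V \<union> W}. card T + rank_excess U V W T = d}"
      by auto
    finally show ?thesis
      by simp
  qed
  also have "\<dots> = (\<Sum>A\<in>Pow U. \<Sum>B\<in>Pow V. \<Sum>C\<in>Pow W. ?h A B C)"
    by (rule sum_Pow_three_parts)
  also have "\<dots> = (\<Sum>A\<in>Pow U. ?h A V W) + (\<Sum>A\<in>Pow U. \<Sum>C | C \<subset> W. ?h A V C) +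
      (\<Sum>A\<in>Pow U. \<Sum>B | B \<subset> V. ?h A B W) + (\<Sum>A\<in>Pow U. \<Sum>B | B \<subset> V. \<Sum>C | C \<subset> W. ?h A B C)"
    by (simp only: sum_Pow_split[OF fin(2)] sum_Pow_split[OF fin(3)] sum.distrib add_ac)
  also have "(\<Sum>A\<in>Pow U. ?h A V W) = (\<Sum>A | A \<subset> U. ?h A V W)"
    using sum_Pow_split[OF fin(1), of "\<lambda>A. ?h A V W"] by (simp add: F_def)
  also have "(\<Sum>A\<in>Pow U. \<Sum>C | C \<subset> W. ?h A V C) =
      (\<Sum>C | C \<subset> W. ?h U V C) + (\<Sum>A | A \<subset> U. \<Sum>C | C \<subset> W. ?h A V C)"
    by (rule sum_Pow_split[OF fin(1)])
  also have "(\<Sum>A\<in>Pow U. \<Sum>B | B \<subset> V. ?h A B W) =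
      (\<Sum>B | B \<subset> V. ?h U B W) + (\<Sum>A | A \<subset> U. \<Sum>B | B \<subset> V. ?h A B W)"
    by (rule sum_Pow_split[OF fin(1)])
  finally show ?thesis
    unfolding t1 t2 t3 t4 t5 t6 unfolding g_def i_def j_def k_def by simp
qed

text \<open>
  If only one part is not inside \<open>T\<close>, then \<open>T\<close> contains two whole parts, of total size at least 1, and
  adding the parity of that size gives at least 2.  For the upper bound, \<open>T\<close> misses at least two loops
  whenever the excess is 2.
\<close>

lemma rank_bounds:
  assumes ne: "U \<noteq> {}" "V \<noteq> {}" and T: "T \<in> Pow (U \<union> V \<union> W) - {U \<union> V \<union> W}"
  shows "card T + rank_excess U V W T \<in> {2..card U + card V + card W}"
proof -
  have union: "card (U \<union> V \<union> W) = card U + card V + card W"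
    using fin disj by (simp add: card_Un_disjoint Int_Un_distrib2)
  have sub: "T \<subseteq> U \<union> V \<union> W" and fT: "finite T"
    using T fin finite_subset[of T "U \<union> V \<union> W"] by auto
  have pos: "card U \<ge> 1" "card V \<ge> 1"
    using ne fin by (simp_all add: Suc_leI card_gt_0_iff)
  have lower: "card A + card B \<le> card T" if "A \<union> B \<subseteq> T" "A \<inter> B = {}" "finite A" "finite B" for A B
    using card_mono[OF fT that(1)] that by (simp add: card_Un_disjoint)
  have missing: "card T + card M \<le> card U + card V + card W"
    if "M \<subseteq> U \<union> V \<union> W" "M \<inter> T = {}" for M
  proof -
    have "finite M"
      using that fin finite_subset[of M "U \<union> V \<union> W"] by auto
    moreover have "card (T \<union> M) \<le> card (U \<union> V \<union> W)"
      using sub that fin by (intro card_mono) auto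
    ultimately show ?thesis
      using that fT union by (simp add: card_Un_disjoint Int_commute)
  qed
  obtain e where e: "e \<in> U \<union> V \<union> W" "e \<notin> T"
    using T by blast
  have one: "card T + 1 \<le> card U + card V + card W"
    using missing[of "{e}"] e by simp
  have two: "card T + 2 \<le> card U + card V + card W"
    if "x \<in> U \<union> V \<union> W" "y \<in> U \<union> V \<union> W" "x \<noteq> y" "x \<notin> T" "y \<notin> T" for x y
    using missing[of "{x, y}"] that by simp
  show ?thesis
  proof (cases "V \<union> W \<subseteq> T \<or> U \<union> W \<subseteq> T \<or> U \<union> V \<subseteq> T")
    case True
    then show ?thesis
      using one pos lower[of V W] lower[of U W] lower[of U V] disj fin
      by (auto simp: rank_excess_def of_bool_def split: if_splits elim!: oddE)
  next
    case False
    then obtain x y where "x \<in> U \<union> V \<union> W" "y \<in> U \<union> V \<union> W" "x \<noteq> y" "x \<notin> T" "y \<notin> T"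
      using disj by blast
    from two[OF this] False show ?thesis
      by (auto simp: rank_excess_def)
  qed
qed

end

section \<open>The partial Petrial polynomial\<close>

lemma corank_eq_card_plus_excess:
  assumes fin: "finite U" "finite V" "finite W"
    and disj: "U \<inter> V = {}" "U \<inter> W = {}" "V \<inter> W = {}"
    and ne: "U \<noteq> {}" "V \<noteq> {}" and T: "T \<in> Pow (U \<union> V \<union> W) - {U \<union> V \<union> W}"
  shows "int (card (U \<union> V \<union> W)) - int (tripartite_nullity U V W T) =
    int (card T + rank_excess U V W T)"
proof -
  let ?E = "U \<union> V \<union> W"
  have "finite T"
    using T fin finite_subset[of T ?E] by auto
  then have z: "card (?E - T) = card ?E - card T" "card T \<le> card ?E"
    using T fin by (auto simp: card_Diff_subset intro!: card_mono)
  have union: "card ?E = card U + card V + card W"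
    using fin disj by (simp add: card_Un_disjoint Int_Un_distrib2)
  have bound: "card T + rank_excess U V W T \<le> card ?E"
    using rank_bounds[OF fin disj ne T] union by simp
  have "\<not> ?E \<subseteq> T"
    using T by auto
  moreover have "V \<union> W \<subseteq> T \<Longrightarrow> U - T = ?E - T" "U \<union> W \<subseteq> T \<Longrightarrow> V - T = ?E - T"
    "U \<union> V \<subseteq> T \<Longrightarrow> W - T = ?E - T"
    by auto
  ultimately have "tripartite_nullity U V W T = card (?E - T) - rank_excess U V W T"
    by (auto simp: tripartite_nullity_def rank_excess_def)
  then show ?thesis
    using bound z by simp
qed

text \<open>
  A uniform description of both cases, with an empty third part in the bipartite one.
\<close>

lemma is_K_parts:
  assumes "is_K i j k (with_proj (intersection_graph B))"
  obtains U V W where "ribbons B = U \<union> V \<union> W" "U \<inter> V = {}" "U \<inter> W = {}" "V \<inter> W = {}"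
    "card U = i" "card V = j" "card W = k"
    "\<And>e f. e \<in> ribbons B \<Longrightarrow> f \<in> ribbons B \<Longrightarrow> interlaced B e f \<longleftrightarrow>
      (e, f) \<in> U \<times> V \<union> V \<times> U \<union> U \<times> W \<union> W \<times> U \<union> V \<times> W \<union> W \<times> V"
proof -
  have ends: "arcs_ends (with_proj (intersection_graph B)) =
      {(e, f). e \<in> ribbons B \<and> f \<in> ribbons B \<and> interlaced B e f}"
    "verts (with_proj (intersection_graph B)) = ribbons B"
    by (simp_all add: intersection_graph_def)
  let ?arcs = "{(e, f). e \<in> ribbons B \<and> f \<in> ribbons B \<and> interlaced B e f}"
  obtain U V W where parts: "ribbons B = U \<union> V \<union> W" "U \<inter> V = {}" "U \<inter> W = {}" "V \<inter> W = {}"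
    "card U = i" "card V = j" "card W = k"
    and arcs: "?arcs = U \<times> V \<union> V \<times> U \<union> U \<times> W \<union> W \<times> U \<union> V \<times> W \<union> W \<times> V"
  proof (cases "k = 0")
    case True
    then have "complete_bipartite_digraph i j (with_proj (intersection_graph B))"
      using assms by (simp add: is_K_def)
    then obtain U V where "ribbons B = U \<union> V" "U \<inter> V = {}" "card U = i" "card V = j"
      "?arcs = U \<times> V \<union> V \<times> U"
      unfolding complete_bipartite_digraph_def ends by (elim conjE exE)
    with True show ?thesis
      by (intro that[of U V "{}"]) simp_all
  next
    case False
    then have "complete_tripartite_digraph i j k (with_proj (intersection_graph B))"
      using assms by (simp add: is_K_def)
    then show ?thesis
      unfolding complete_tripartite_digraph_def ends by (elim conjE exE) (rule that)
  qed
  have "interlaced B e f \<longleftrightarrow> (e, f) \<in> U \<times> V \<union> V \<times> U \<union> U \<times> W \<union> W \<times> U \<union> V \<times> W \<union> W \<times> V"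
    if "e \<in> ribbons B" "f \<in> ribbons B" for e f
    using that unfolding arcs[symmetric] by simp
  with parts show ?thesis
    by (rule that)
qed

lemma parity_kernel_tripartite:
  assumes E: "ribbons G = U \<union> V \<union> W" and fin: "finite U" "finite V" "finite W"
    and disj: "U \<inter> V = {}" "U \<inter> W = {}" "V \<inter> W = {}"
    and adj: "\<And>e f. e \<in> ribbons G \<Longrightarrow> f \<in> ribbons G \<Longrightarrow> interlaced G e f \<longleftrightarrow>
      (e, f) \<in> U \<times> V \<union> V \<times> U \<union> U \<times> W \<union> W \<times> U \<union> V \<times> W \<union> W \<times> V"
  shows "parity_kernel G = tripartite_kernel U V W (twisted G)"
proof -
  have nbr: "(e \<in> U \<longrightarrow> card {f \<in> X. interlaced G e f} = card (X \<inter> V) + card (X \<inter> W)) \<and>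
      (e \<in> V \<longrightarrow> card {f \<in> X. interlaced G e f} = card (X \<inter> U) + card (X \<inter> W)) \<and>
      (e \<in> W \<longrightarrow> card {f \<in> X. interlaced G e f} = card (X \<inter> U) + card (X \<inter> V))"
    if X: "X \<subseteq> U \<union> V \<union> W" for e X
  proof -
    have "finite X"
      using X fin finite_subset[of X "U \<union> V \<union> W"] by auto
    then have un: "card ((X \<inter> P) \<union> (X \<inter> Q)) = card (X \<inter> P) + card (X \<inter> Q)" if "P \<inter> Q = {}" for P Q
      using that by (intro card_Un_disjoint) auto
    have iff: "interlaced G e f \<longleftrightarrow> (e \<in> U \<and> (f \<in> V \<or> f \<in> W)) \<or> (e \<in> V \<and> (f \<in> U \<or> f \<in> W)) \<or>
        (e \<in> W \<and> (f \<in> U \<or> f \<in> V))" if "e \<in> ribbons G" "f \<in> X" for f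
      using that X adj[of e f] unfolding E by auto
    have "{f \<in> X. interlaced G e f} = (X \<inter> V) \<union> (X \<inter> W)" if "e \<in> U"
    proof -
      have "e \<in> ribbons G" "e \<notin> V" "e \<notin> W"
        using that disj by (auto simp: E)
      then show ?thesis
        using iff that by auto
    qed
    moreover have "{f \<in> X. interlaced G e f} = (X \<inter> U) \<union> (X \<inter> W)" if "e \<in> V"
    proof -
      have "e \<in> ribbons G" "e \<notin> U" "e \<notin> W"
        using that disj by (auto simp: E)
      then show ?thesis
        using iff that by auto
    qed
    moreover have "{f \<in> X. interlaced G e f} = (X \<inter> U) \<union> (X \<inter> V)" if "e \<in> W"
    proof -
      have "e \<in> ribbons G" "e \<notin> U" "e \<notin> V"
        using that disj by (auto simp: E)
      then show ?thesis
        using iff that by auto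
    qed
    ultimately show ?thesis
      using un disj by simp
  qed
  show ?thesis
    unfolding parity_kernel_def tripartite_kernel_def E using nbr by (auto simp: ball_Un)
qed

lemma one_disc_partial_petrial:
  assumes "ribbon_graph B" "vertex_discs B = {v}" "A \<subseteq> ribbons B"
  shows "one_disc (partial_petrial B A) v"
  using assms by unfold_locales (auto simp: partial_petrial_def ribbon_graph_def half_edges_def)

lemma interlaced_partial_petrial: "interlaced (partial_petrial B A) = interlaced B"
  by (simp add: partial_petrial_def interlaced_def fun_eq_iff)

text \<open>
  Taking the symmetric difference with the original twists is an involution on sets of ribbons, so the
  twist sets of the partial Petrials are all sets of ribbons, each occurring once.
\<close>

lemma partial_petrial_polynomial_by_twists:
  assumes "twisted B \<subseteq> ribbons B"
    and "\<And>A. A \<subseteq> ribbons B \<Longrightarrow>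
      euler_genus (partial_petrial B A) = \<rho> (twisted (partial_petrial B A))"
  shows "partial_petrial_polynomial B = (\<Sum>T\<in>Pow (ribbons B). monom 1 (nat (\<rho> T)))"
proof -
  let ?flip = "\<lambda>A. twisted (partial_petrial B A)"
  have "bij_betw ?flip (Pow (ribbons B)) (Pow (ribbons B))"
    by (rule bij_betw_byWitness[where f' = ?flip]) (use assms(1) in \<open>auto simp: partial_petrial_def\<close>)
  then have "(\<Sum>T\<in>Pow (ribbons B). monom (1::int) (nat (\<rho> T))) =
      (\<Sum>A\<in>Pow (ribbons B). monom 1 (nat (\<rho> (?flip A))))"
    by (rule sum.reindex_bij_betw[symmetric])
  then show ?thesis
    using assms(2) by (simp add: partial_petrial_polynomial_def)
qed

theorem theorem4p5:
  fixes B :: "('v, 'e) ribbon_graph" and n i j k :: nat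
  assumes "bouquet B"
    and "card (ribbons B) = n"
    and "n \<ge> 3"
    and "i \<ge> 1" and "j \<ge> 1"
    and "is_K i j k (with_proj (intersection_graph B))"
    and "k = 0 \<or> (i + j \<ge> 3 \<and> k \<noteq> 0)"
  shows "partial_petrial_polynomial B =
    (if num_odd i j k = 0
     then monom 1 n + (\<Sum>d = 2..n. monom (int (g i j k d)) d)
     else monom 1 (n + 1 - num_odd i j k) + (\<Sum>d = 2..n. monom (int (g i j k d)) d))"
proof -
  obtain v where B: "ribbon_graph B" "vertex_discs B = {v}"
    using assms(1) by (auto simp: bouquet_def card_1_singleton_iff)
  then have finB: "finite (ribbons B)" and tw: "twisted B \<subseteq> ribbons B"
    by (auto simp: ribbon_graph_def)
  obtain U V W where E: "ribbons B = U \<union> V \<union> W" and disj: "U \<inter> V = {}" "U \<inter> W = {}" "V \<inter> W = {}"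
    and card: "card U = i" "card V = j" "card W = k"
    and adj: "\<And>e f. e \<in> ribbons B \<Longrightarrow> f \<in> ribbons B \<Longrightarrow> interlaced B e f \<longleftrightarrow>
      (e, f) \<in> U \<times> V \<union> V \<times> U \<union> U \<times> W \<union> W \<times> U \<union> V \<times> W \<union> W \<times> V"
    using is_K_parts[OF assms(6)] by metis
  have fin: "finite U" "finite V" "finite W"
    using finB E by auto
  have ne: "U \<noteq> {}" "V \<noteq> {}"
    using card assms(4,5) by auto
  let ?E = "U \<union> V \<union> W"
  have n: "card ?E = n" "n = i + j + k"
    using assms(2) E fin disj card by (auto simp: card_Un_disjoint Int_Un_distrib2)
  define \<rho> where "\<rho> T = int n - int (tripartite_nullity U V W T)" for T
  have genus: "euler_genus (partial_petrial B A) = \<rho> (twisted (partial_petrial B A))"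
    if A: "A \<subseteq> ribbons B" for A
  proof -
    let ?G = "partial_petrial B A"
    interpret one_disc ?G v
      by (rule one_disc_partial_petrial[OF B A])
    have rib: "ribbons ?G = ribbons B"
      by (simp add: partial_petrial_def)
    have "parity_kernel ?G = tripartite_kernel U V W (twisted ?G)"
      using adj by (intro parity_kernel_tripartite fin disj) (simp_all add: rib E interlaced_partial_petrial)
    then have "card (parity_kernel ?G) = 2 ^ tripartite_nullity U V W (twisted ?G)"
      using card_tripartite_kernel[OF fin disj] by simp
    then show ?thesis
      using euler_genus_eq_corank ne E n by (simp add: rib \<rho>_def)
  qed
  let ?P = "Pow ?E - {?E}"
  have proper: "nat (\<rho> T) = card T + rank_excess U V W T" if "T \<in> ?P" for T
    using corank_eq_card_plus_excess[OF fin disj ne that] n by (simp add: \<rho>_def)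
  have full: "nat (\<rho> ?E) = (if num_odd i j k = 0 then n else n + 1 - num_odd i j k)"
    using assms(3) by (auto simp: \<rho>_def tripartite_nullity_def card)
  have "partial_petrial_polynomial B = (\<Sum>T\<in>Pow ?E. monom 1 (nat (\<rho> T)))"
    using partial_petrial_polynomial_by_twists[OF tw genus] by (simp add: E)
  also have "\<dots> = monom 1 (nat (\<rho> ?E)) + (\<Sum>T\<in>?P. monom 1 (nat (\<rho> T)))"
    using fin by (intro sum.remove) auto
  also have "(\<Sum>T\<in>?P. monom (1::int) (nat (\<rho> T))) =
      (\<Sum>T\<in>?P. monom 1 (card T + rank_excess U V W T))"
    using proper by (intro sum.cong) simp_all
  also have "\<dots> = (\<Sum>d = 2..n.
      monom (int (card {T \<in> ?P. card T + rank_excess U V W T = d})) d)"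
  proof (rule sum_monom_fibres)
    show "finite ?P"
      using fin by simp
    show "(\<lambda>T. card T + rank_excess U V W T) ` ?P \<subseteq> {2..n}"
      using rank_bounds[OF fin disj ne] unfolding card n(2)[symmetric] by (rule image_subsetI)
  qed simp
  also have "\<dots> = (\<Sum>d = 2..n. monom (int (g i j k d)) d)"
    by (simp only: count_by_rank[OF fin disj ne] card)
  finally show ?thesis
    by (simp add: full)
qed

end
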